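(* Fix $m$ and the protocol parameters $k,\gamma,\tau_{\max},\tau_{\min},Q,\alpha,\beta,\lambda$. There is a constant $c_2>0$, independent of the number of voters $n$, such that for any non-terminal system state $S_t$ of the Snowveil process with $n>k$ voters, the probability that a randomly chosen unlocked voter transitions to a locked state is at least $c_2$.
   Context: Setting. There are $n$ voters $V=\{v_1,\dots,v_n\}$ and $m$ candidates $\mathcal P=\{p_1,\dots,p_m\}$; voter $v_i$ has a fixed strict complete ranking (ballot) $R_i$ of $\mathcal P$. Parameters: sample size $k$, number of rounds $\gamma\ge1$, thresholds $\tau_{\max}=\lfloor\gamma/2\rfloor+1$ and $\tau_{\min}$, quorum $Q\in(1/2,1]$, and $\alpha,\beta,\lambda\in[0,1]$. Aggregation rule. $F=F_{\mathrm{CHB}}$, the Constrained Hybrid Borda rule, is defined on profiles of $k$ ballots. The Borda score $B(p_j)$ sums over ballots the points $m-i$ for position $i$ ($i=1$ top); $t_j$ is the number of ballots ranking $p_j$ first; $p_j$ is $\alpha$-popular if $t_j\ge\lceil\alpha k\rceil$; $H(p_j)=(1-\lambda)\frac{B(p_j)}{k(m-1)}+\lambda\frac{t_j}{k}$. If the candidate $p_B$ of maximum Borda score $B_{\max}$ is $\alpha$-popular it wins; otherwise, among eligible candidates ($\alpha$-popular with $B(p_j)\ge\beta B_{\max}$) the one with highest $H$ wins; if none is eligible, $p_B$ wins. Ties at every stage go to the lowest index. States. At time $t$ voter $v_i$ has state $s_i(t)\in\mathcal P\cup\{\bot\}$ (locked on a candidate, or unlocked, $\bot$); $S_t=(s_1(t),\dots,s_n(t))$;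 $N_j(t)$ is the number of voters locked on $p_j$; $U(t)$ is the set of unlocked voters. A state is non-terminal if $N_j(t)<\lceil Qn\rceil$ for all $j$ and $U(t)\ne\emptyset$. Locks are permanent. When sampled, an unlocked voter $v_i$ submits $R_i$, and a voter locked on $p$ submits a ballot (determined by $R_i$ and $p$) with $p$ in first position. Step. In a non-terminal state a voter $v$ is chosen uniformly at random from $U(t)$ and runs the update process: for rounds $r=1,\dots,\gamma$ it independently draws a uniformly random set of $k$ voters from $V\setminus\{v\}$, computes $p_r^*=F(\text{their ballots})$, and increments a counter $C[p_r^*]$ (initially $0$); if $C[p_r^*]\ge\tau_{\max}$ it immediately locks on $p_r^*$. If no early lock occurs after $\gamma$ rounds, then if $\max_p C[p]<\tau_{\min}$ it stays unlocked (NO-LOCK), and otherwise it locks on the candidate with maximum counter, ties being broken in favour of the tied candidate that won most recently. *)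

theory Defs
  imports "HOL-Probability.Probability" "HOL-Combinatorics.Multiset_Permutations"
begin

text \<open>Candidates are the indices \<open>1, \<dots>, m\<close> and voters the indices \<open>1, \<dots>, n\<close>. A ballot lists the
  candidates from top to bottom.\<close>

type_synonym cand = nat
type_synonym voter = nat
type_synonym ballot = "cand list"
type_synonym state = "voter \<Rightarrow> cand option"  \<comment> \<open>\<open>None\<close> is the unlocked state \<open>\<bottom>\<close>\<close>

definition rankings :: "nat \<Rightarrow> ballot set" where
  "rankings m = permutations_of_set {1..m}"


section \<open>The Constrained Hybrid Borda rule\<close>

text \<open>Positions start at 1 (top).\<close>

definition position :: "ballot \<Rightarrow> cand \<Rightarrow> nat" where
  "position b p = Suc (length (takeWhile (\<lambda>q. q \<noteq> p) b))"

definition borda :: "nat \<Rightarrow> ballot multiset \<Rightarrow> cand \<Rightarrow> nat" where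
  "borda m P p = (\<Sum>b\<in>#P. m - position b p)"

definition tops :: "ballot multiset \<Rightarrow> cand \<Rightarrow> nat" where
  "tops P p = size {#b \<in># P. hd b = p#}"

definition popular :: "nat \<Rightarrow> real \<Rightarrow> ballot multiset \<Rightarrow> cand \<Rightarrow> bool" where
  "popular k \<alpha> P p \<longleftrightarrow> int (tops P p) \<ge> \<lceil>\<alpha> * real k\<rceil>"

text \<open>For \<open>m = 1\<close> the first fraction is \<open>0 / 0 = 0\<close>; the score is then irrelevant to the outcome.\<close>

definition hybrid :: "nat \<Rightarrow> nat \<Rightarrow> real \<Rightarrow> ballot multiset \<Rightarrow> cand \<Rightarrow> real" where
  "hybrid m k lam P p =
     (1 - lam) * (real (borda m P p) / (real k * (real m - 1))) + lam * (real (tops P p) / real k)"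

definition lowest_arg_max :: "(cand \<Rightarrow> 'a::linorder) \<Rightarrow> cand set \<Rightarrow> cand" where
  "lowest_arg_max f A = (LEAST p. is_arg_max f (\<lambda>q. q \<in> A) p)"

definition borda_winner :: "nat \<Rightarrow> ballot multiset \<Rightarrow> cand" where
  "borda_winner m P = lowest_arg_max (borda m P) {1..m}"

definition eligible :: "nat \<Rightarrow> nat \<Rightarrow> real \<Rightarrow> real \<Rightarrow> ballot multiset \<Rightarrow> cand set" where
  "eligible m k \<alpha> \<beta> P =
     {p \<in> {1..m}. popular k \<alpha> P p \<and> real (borda m P p) \<ge> \<beta> * real (Max (borda m P ` {1..m}))}"

definition chb :: "nat \<Rightarrow> nat \<Rightarrow> real \<Rightarrow> real \<Rightarrow> real \<Rightarrow> ballot multiset \<Rightarrow> cand" where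
  "chb m k \<alpha> \<beta> lam P =
     (if popular k \<alpha> P (borda_winner m P) then borda_winner m P
      else if eligible m k \<alpha> \<beta> P \<noteq> {} then lowest_arg_max (hybrid m k lam P) (eligible m k \<alpha> \<beta> P)
      else borda_winner m P)"


section \<open>States\<close>

definition valid_state :: "nat \<Rightarrow> nat \<Rightarrow> state \<Rightarrow> bool" where
  "valid_state n m s \<longleftrightarrow> (\<forall>i\<in>{1..n}. s i \<in> insert None (Some ` {1..m}))"

definition locked_on :: "nat \<Rightarrow> state \<Rightarrow> cand \<Rightarrow> nat" where
  "locked_on n s p = card {i \<in> {1..n}. s i = Some p}"

definition unlocked :: "nat \<Rightarrow> state \<Rightarrow> voter set" where
  "unlocked n s = {i \<in> {1..n}. s i = None}"

definition non_terminal :: "nat \<Rightarrow> nat \<Rightarrow> real \<Rightarrow> state \<Rightarrow> bool" where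
  "non_terminal n m Q s \<longleftrightarrow>
     (\<forall>p\<in>{1..m}. int (locked_on n s p) < \<lceil>Q * real n\<rceil>) \<and> unlocked n s \<noteq> {}"

text \<open>The argument \<open>L\<close> below maps a voter's ranking and the candidate the voter is locked on to the
  ballot the voter then submits.\<close>

definition lock_ballot_rule :: "nat \<Rightarrow> (ballot \<Rightarrow> cand \<Rightarrow> ballot) \<Rightarrow> bool" where
  "lock_ballot_rule m L \<longleftrightarrow>
     (\<forall>b\<in>rankings m. \<forall>p\<in>{1..m}. L b p \<in> rankings m \<and> hd (L b p) = p)"

definition submitted ::
  "(voter \<Rightarrow> ballot) \<Rightarrow> (ballot \<Rightarrow> cand \<Rightarrow> ballot) \<Rightarrow> state \<Rightarrow> voter \<Rightarrow> ballot" where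
  "submitted R L s i = (case s i of None \<Rightarrow> R i | Some p \<Rightarrow> L (R i) p)"


section \<open>The update process\<close>

definition round_winner ::
  "nat \<Rightarrow> nat \<Rightarrow> (ballot multiset \<Rightarrow> cand) \<Rightarrow> (voter \<Rightarrow> ballot) \<Rightarrow> voter \<Rightarrow> cand pmf" where
  "round_winner n k F sub v =
     map_pmf (\<lambda>A. F (image_mset sub (mset_set A)))
       (pmf_of_set {A. A \<subseteq> {1..n} - {v} \<and> card A = k})"

text \<open>The list \<open>h\<close> records the round winners so far, most recent first; the counter \<open>C[p]\<close> is
  \<open>count_list h p\<close>. The result \<open>None\<close> is NO-LOCK.\<close>

definition final_decision :: "nat \<Rightarrow> nat \<Rightarrow> cand list \<Rightarrow> cand option" where
  "final_decision m \<tau>min h =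
     (let M = Max (count_list h ` {1..m})
      in if M < \<tau>min then None else Some (hd (filter (\<lambda>p. count_list h p = M) h)))"

text \<open>\<open>D\<close> is the law of a single round winner; the recursion is on the number of remaining rounds.\<close>

primrec run_rounds ::
  "nat \<Rightarrow> nat \<Rightarrow> nat \<Rightarrow> cand pmf \<Rightarrow> nat \<Rightarrow> cand list \<Rightarrow> cand option pmf" where
  "run_rounds m \<tau>max \<tau>min D 0 h = return_pmf (final_decision m \<tau>min h)"
| "run_rounds m \<tau>max \<tau>min D (Suc r) h =
     do { p \<leftarrow> D;
          if count_list (p # h) p \<ge> \<tau>max then return_pmf (Some p)
          else run_rounds m \<tau>max \<tau>min D r (p # h) }"

text \<open>One step of the process: the chosen voter together with the next state.\<close>

definition step ::
  "nat \<Rightarrow> nat \<Rightarrow> nat \<Rightarrow> nat \<Rightarrow> nat \<Rightarrow> nat \<Rightarrow> (ballot multiset \<Rightarrow> cand) \<Rightarrow> (voter \<Rightarrow> ballot)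
     \<Rightarrow> (ballot \<Rightarrow> cand \<Rightarrow> ballot) \<Rightarrow> state \<Rightarrow> (voter \<times> state) pmf" where
  "step n m k \<gamma> \<tau>max \<tau>min F R L s =
     do { v \<leftarrow> pmf_of_set (unlocked n s);
          r \<leftarrow> run_rounds m \<tau>max \<tau>min (round_winner n k F (submitted R L s) v) \<gamma> [];
          return_pmf (v, s(v := r)) }"

end

theory Submission imports Defs begin

text \<open>Whatever the ballots, the Constrained Hybrid Borda rule elects one of the \<open>m\<close> candidates, so some
  candidate wins a round with probability at least \<open>1/m\<close>. The rounds are independent with the same
  law, and \<open>\<tau>max \<le> \<gamma>\<close>, so with probability at least \<open>(1/m)^\<gamma>\<close> this candidate wins round after round
  until its counter reaches \<open>\<tau>max\<close> and the voter locks early.\<close>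

lemma lowest_arg_max_in:
  assumes "finite A" and "A \<noteq> {}"
  shows "lowest_arg_max f A \<in> A"
proof -
  from assms obtain x where "x \<in> A" and "f x = Max (f ` A)"
    using Max_in[of "f ` A"] by fastforce
  with assms have "is_arg_max f (\<lambda>q. q \<in> A) x"
    by (auto simp: is_arg_max_linorder)
  then have "is_arg_max f (\<lambda>q. q \<in> A) (lowest_arg_max f A)"
    unfolding lowest_arg_max_def by (rule LeastI)
  then show ?thesis
    by (simp add: is_arg_max_def)
qed

text \<open>Each branch of the rule maximises over a nonempty subset of \<open>{1..m}\<close>, the
  middle one thanks to its own guard, so no property of the ballots enters.\<close>

lemma chb_in_candidates:
  assumes "m \<ge> 1"
  shows "chb m k \<alpha> \<beta> lam P \<in> {1..m}"
proof -
  have "borda_winner m P \<in> {1..m}"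
    unfolding borda_winner_def using assms by (intro lowest_arg_max_in) auto
  moreover have "lowest_arg_max (hybrid m k lam P) (eligible m k \<alpha> \<beta> P) \<in> {1..m}"
    if "eligible m k \<alpha> \<beta> P \<noteq> {}"
  proof -
    have "eligible m k \<alpha> \<beta> P \<subseteq> {1..m}"
      by (auto simp: eligible_def)
    then show ?thesis
      using lowest_arg_max_in[OF _ that] finite_subset by blast
  qed
  ultimately show ?thesis
    by (simp add: chb_def)
qed

text \<open>Pigeonhole: weights all below the average \<open>1 / card A\<close> could not sum to
  1.\<close>

lemma ex_pmf_ge_inverse_card:
  assumes "finite A" and "set_pmf D \<subseteq> A"
  shows "\<exists>x\<in>A. pmf D x \<ge> 1 / real (card A)"
proof (rule ccontr)
  assume "\<not> ?thesis"
  then have less: "pmf D x < 1 / real (card A)" if "x \<in> A" for x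
    using that by force
  have "A \<noteq> {}"
    using assms(2) set_pmf_not_empty[of D] by blast
  then have "(\<Sum>x\<in>A. pmf D x) < (\<Sum>x\<in>A. 1 / real (card A))"
    using assms(1) less by (intro sum_strict_mono) auto
  also have "\<dots> = 1"
    using assms(1) \<open>A \<noteq> {}\<close> by simp
  finally show False
    using sum_pmf_eq_1[OF assms] by simp
qed

text \<open>Law of total probability, with the outcomes outside \<open>B\<close> bounded below by
  0.\<close>

lemma prob_bind_pmf_ge:
  assumes "\<And>x. x \<in> set_pmf M \<Longrightarrow> x \<in> B \<Longrightarrow> c \<le> measure_pmf.prob (f x) A"
  shows "measure_pmf.prob M B * c \<le> measure_pmf.prob (bind_pmf M f) A"
proof -
  have "measure_pmf.prob M B * c = (\<integral>x. indicator B x * c \<partial>measure_pmf M)"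
    by simp
  also have "\<dots> \<le> (\<integral>x. measure_pmf.prob (f x) A \<partial>measure_pmf M)"
    using assms
    by (intro integral_mono_AE measure_pmf.integrable_const_bound[where B = 1]
          integrable_mult_left integrable_real_indicator)
       (auto simp: AE_measure_pmf_iff indicator_def)
  also have "\<dots> = measure_pmf.prob (bind_pmf M f) A"
    unfolding measure_pmf_bind
    by (rule measure_pmf.measure_bind[where N = "count_space UNIV", symmetric])
       (auto simp: space_subprob_algebra subprob_space_measure_pmf)
  finally show ?thesis .
qed

text \<open>The hypotheses say that \<open>p\<close> has not locked yet but would do so by winning
  all \<open>r\<close> remaining rounds. A win of \<open>p\<close> moves one unit from
  \<open>r\<close> to the counter and so preserves their sum.\<close>

lemma run_rounds_lock_prob_ge:
  assumes "count_list h p < \<tau>max" and "\<tau>max \<le> count_list h p + r"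
  shows "pmf D p ^ r \<le> measure_pmf.prob (run_rounds m \<tau>max \<tau>min D r h) (- {None})"
  using assms
proof (induction r arbitrary: h)
  \<comment> \<open>With no round left the hypotheses contradict each other, so
    \<open>final_decision\<close> never has to be analysed.\<close>
  case 0
  then show ?case by simp
next
  case (Suc r)
  let ?f = "\<lambda>p. if count_list (p # h) p \<ge> \<tau>max then return_pmf (Some p)
                else run_rounds m \<tau>max \<tau>min D r (p # h)"
  \<comment> \<open>Either this win reaches \<tau>max and the lock is certain, with 1 as an upper
    bound of the power, or the induction hypothesis applies to \<open>p # h\<close>.\<close>
  have "pmf D p ^ r \<le> measure_pmf.prob (?f p) (- {None})"
    using Suc by (auto intro: power_le_one simp: pmf_le_1)
  then have "measure_pmf.prob D {p} * pmf D p ^ r \<le> measure_pmf.prob (bind_pmf D ?f) (- {None})"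
    by (intro prob_bind_pmf_ge) auto
  then show ?case
    by (simp add: measure_pmf_single)
qed

theorem lemma7p1:
  fixes m k \<gamma> \<tau>max \<tau>min :: nat and Q \<alpha> \<beta> lam :: real
  assumes "m \<ge> 1" and "k \<ge> 1" and "\<gamma> \<ge> 1"
    and "\<tau>max = \<gamma> div 2 + 1"
    and "1/2 < Q" and "Q \<le> 1"
    and "\<alpha> \<in> {0..1}" and "\<beta> \<in> {0..1}" and "lam \<in> {0..1}"
  shows "\<exists>c\<^sub>2::real. c\<^sub>2 > 0 \<and>
    (\<forall>(n::nat) (R :: voter \<Rightarrow> ballot) (L :: ballot \<Rightarrow> cand \<Rightarrow> ballot) (s :: state).
       n > k \<longrightarrow> (\<forall>i\<in>{1..n}. R i \<in> rankings m) \<longrightarrow> lock_ballot_rule m L \<longrightarrow>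
       valid_state n m s \<longrightarrow> non_terminal n m Q s \<longrightarrow>
       measure_pmf.prob (step n m k \<gamma> \<tau>max \<tau>min (chb m k \<alpha> \<beta> lam) R L s) {(v, s'). s' v \<noteq> None}
         \<ge> c\<^sub>2)"
\<comment> \<open>The witness involves only m and \<gamma>, hence is the same for all n, ballots and
  states.\<close>
proof (intro exI[of _ "(1 / real m) ^ \<gamma>"] conjI allI impI)
  show "0 < (1 / real m) ^ \<gamma>"
    using \<open>m \<ge> 1\<close> by simp
next
  fix n :: nat and R :: "voter \<Rightarrow> ballot" and L :: "ballot \<Rightarrow> cand \<Rightarrow> ballot" and s :: state
  let ?F = "chb m k \<alpha> \<beta> lam"
  let ?locked = "{(v, s'). s' v \<noteq> None} :: (voter \<times> state) set"
  let ?D = "round_winner n k ?F (submitted R L s)"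
  let ?run = "\<lambda>v. run_rounds m \<tau>max \<tau>min (?D v) \<gamma> []"
  have run: "(1 / real m) ^ \<gamma> \<le> measure_pmf.prob (?run v) (- {None})" for v
  proof -
    have "set_pmf (?D v) \<subseteq> {1..m}"
      using chb_in_candidates[OF \<open>m \<ge> 1\<close>] by (auto simp: round_winner_def simp del: atLeastAtMost_iff)
    \<comment> \<open>The candidate \<open>p\<close> may vary with the voter and the state; the
      bound \<open>1 / real m\<close> does not.\<close>
    then obtain p where "1 / real m \<le> pmf (?D v) p"
      using ex_pmf_ge_inverse_card[of "{1..m}"] by auto
    then have "(1 / real m) ^ \<gamma> \<le> pmf (?D v) p ^ \<gamma>"
      by (intro power_mono) auto
    also have "\<dots> \<le> measure_pmf.prob (?run v) (- {None})"
      \<comment> \<open>From the empty history this needs \<open>0 < \<gamma> div 2 + 1\<close> and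
        \<open>\<gamma> div 2 + 1 \<le> \<gamma>\<close>; the latter is an equality at \<gamma> =
        1.\<close>
      using \<open>\<gamma> \<ge> 1\<close> \<open>\<tau>max = \<gamma> div 2 + 1\<close> by (intro run_rounds_lock_prob_ge) auto
    finally show ?thesis .
  qed
  have "(1 / real m) ^ \<gamma>
      \<le> measure_pmf.prob (?run v \<bind> (\<lambda>r. return_pmf (v, s(v := r)))) ?locked" for v
    using run[of v]
      prob_bind_pmf_ge[of "?run v" "- {None}" 1 "\<lambda>r. return_pmf (v, s(v := r))" ?locked]
    by simp
  \<comment> \<open>The bound is uniform in \<open>v\<close>, so it survives averaging over the
    random unlocked voter.\<close>
  then show "(1 / real m) ^ \<gamma>
      \<le> measure_pmf.prob (step n m k \<gamma> \<tau>max \<tau>min ?F R L s) ?locked"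
    using prob_bind_pmf_ge[of "pmf_of_set (unlocked n s)" UNIV "(1 / real m) ^ \<gamma>" _ ?locked]
    unfolding step_def by simp
qed

end
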